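(* Let $\alpha$ be an element of the semigroup $\mathcal{PO}_{\infty}(\mathbb{N}^3_{\leqslant})$ such that $(\mathcal{K}_i\cap\operatorname{dom}\alpha)\alpha\subseteq \mathcal{K}_i$ for all $i=1,2,3$. Then the following assertions hold: (i) if $(x_1,x_2,x_3)\in\operatorname{dom}\alpha$ and $(x_1,x_2,x_3)\alpha=(x_1^\alpha,x_2^\alpha,x_3^\alpha)$, then $x_1^\alpha\le x_1$, $x_2^\alpha\le x_2$ and $x_3^\alpha\le x_3$, and hence $(\overline{x})\alpha\leqslant\overline{x}$ for any $\overline{x}\in\operatorname{dom}\alpha$; (ii) there exists a smallest positive integer $n_{\alpha}$ such that $(x_1,x_2,x_3)\alpha=(x_1,x_2,x_3)$ for all $(x_1,x_2,x_3)\in\operatorname{dom}\alpha\cap{\uparrow}(n_{\alpha},n_{\alpha},n_{\alpha})$.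
   Context: $\mathbb{N}$ is the set of positive integers, and $\mathbb{N}^3_{\leqslant}$ is the set $\mathbb{N}^3$ with the product order: $(i_1,i_2,i_3)\leqslant(j_1,j_2,j_3)$ iff $i_k\le j_k$ for all $k$. For $\overline{x}\in\mathbb{N}^3$, ${\uparrow}\overline{x}=\{\overline{y}\in\mathbb{N}^3:\overline{x}\leqslant\overline{y}\}$. A partial map $\alpha$ of a poset is monotone if $x\leqslant y$ implies $(x)\alpha\leqslant(y)\alpha$ for all $x,y\in\operatorname{dom}\alpha$. Maps are written on the right, and partial maps are composed by $(x)(\alpha\beta)=((x)\alpha)\beta$ with $\operatorname{dom}(\alpha\beta)=\{y\in\operatorname{dom}\alpha: (y)\alpha\in\operatorname{dom}\beta\}$. $\mathcal{PO}_{\infty}(\mathbb{N}^3_{\leqslant})$ is the semigroup, under this composition, of all injective monotone partial selfmaps $\alpha$ of $\mathbb{N}^3_{\leqslant}$ such that $\mathbb{N}^3\setminus\operatorname{dom}\alpha$ and $\mathbb{N}^3\setminus\operatorname{ran}\alpha$ are finite. For $i=1,2,3$, $\mathcal{K}_i$ is the set of all points of $\mathbb{N}^3$ whose $k$-th coordinate equals $1$ for every $k\neq i$ (the $i$-th coordinate being arbitrary). *)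

theory Defs
  imports Main "HOL-Library.Product_Order"
begin

text \<open>
  The order on triples is the componentwise one of \<^theory>\<open>HOL-Library.Product_Order\<close>.
  Positive integers are rendered as a carrier inside \<^typ>\<open>nat\<close>, so the poset in question is
  \<open>N3\<close> with the induced order.
\<close>

type_synonym triple = "nat \<times> nat \<times> nat"

definition N3 :: "triple set" where
  "N3 = {(x1, x2, x3). 1 \<le> x1 \<and> 1 \<le> x2 \<and> 1 \<le> x3}"

definition up :: "triple \<Rightarrow> triple set" where
  "up x = {y \<in> N3. x \<le> y}"

text \<open>Only the indices 1, 2, 3 are meaningful.\<close>

fun coord :: "nat \<Rightarrow> triple \<Rightarrow> nat" where
  "coord k (x1, x2, x3) = (if k = 1 then x1 else if k = 2 then x2 else x3)"

definition K :: "nat \<Rightarrow> triple set" where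
  "K i = {x \<in> N3. \<forall>k\<in>{1, 2, 3}. k \<noteq> i \<longrightarrow> coord k x = 1}"

text \<open>
  Partial selfmaps are maps in the sense of \<open>HOL.Map\<close> whose domain and range lie in \<open>N3\<close>.
  The semigroup operation (the product of \<open>\<alpha>\<close> and \<open>\<beta>\<close>, written on the right, is
  \<open>\<beta> \<circ>\<^sub>m \<alpha>\<close>) plays no role below, so only the underlying set is introduced.
\<close>

definition PO_inf :: "(triple \<rightharpoonup> triple) set" where
  "PO_inf = {\<alpha>. dom \<alpha> \<subseteq> N3 \<and> ran \<alpha> \<subseteq> N3 \<and>
     inj_on (the \<circ> \<alpha>) (dom \<alpha>) \<and>
     monotone_on (dom \<alpha>) (\<le>) (\<le>) (the \<circ> \<alpha>) \<and>
     finite (N3 - dom \<alpha>) \<and> finite (N3 - ran \<alpha>)}"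

end

theory Submission
  imports Defs
begin

text \<open>
  Both assertions are counting arguments: a monotone map sends up-sets into up-sets and down-sets
  into down-sets, and a map that misses only finitely many points of its source and target cannot
  change the number of points of a large finite set by more than a constant.

  For (i), suppose that \<open>x\<close> has first coordinate \<open>a\<close> while its image has first coordinate
  \<open>a' > a\<close>. A point that is above none of \<open>x\<close>, \<open>(A,1,1)\<close>, \<open>(1,n,1)\<close>, \<open>(1,1,n)\<close> lies in a
  box of sides \<open>A\<close>, \<open>n\<close>, \<open>n\<close>. With \<open>A\<close> fixed and \<open>n\<close> growing there are at most
  \<open>(a - 1) n\<^sup>2 + O(n)\<close> such points. By monotonicity, every attained value that is above none of
  the four images has its preimage among them. Now the axes are mapped into
  themselves, injectively and monotonically, so the images of the last three points are again on
  the axes, and those of the last two are at distance \<open>n - O(1)\<close>; if \<open>A\<close> is chosen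
  large enough, the points above none of the four images include the whole box of sides
  \<open>a' - 1\<close>, \<open>n - O(1)\<close>, \<open>n - O(1)\<close>, which has at least \<open>a n\<^sup>2 - O(n)\<close> points.
  This contradicts the upper bound (\<open>fst_image_le\<close>). The other two coordinates follow by
  rotating the coordinate system (\<open>rotated\<close>).

  For (ii), let \<open>d\<close> be the number of points outside the domain, and let \<open>x = (a,b,c)\<close> have
  image \<open>x' \<le> x\<close>. The at least \<open>a b c - d\<close> points of the domain below \<open>x\<close> are mapped
  injectively below \<open>x'\<close>. But if \<open>x' \<noteq> x\<close>, then the box below \<open>x'\<close> lacks at least one whole
  face of the box below \<open>x\<close>, so \<open>d\<close> is at least the size of a face (\<open>face_le_missing\<close>). All
  faces have more than \<open>d\<close> points once \<open>a, b, c > d\<close>.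
\<close>

section \<open>Preliminaries on triples and numbers\<close>

lemma N3_iff [simp]: "(a, b, c) \<in> N3 \<longleftrightarrow> 1 \<le> a \<and> 1 \<le> b \<and> 1 \<le> c"
  by (simp add: N3_def)

lemma finite_triples_bounded:
  fixes F :: "triple set"
  assumes "finite F"
  obtains N where "\<And>a b c. (a, b, c) \<in> F \<Longrightarrow> a < N \<and> b < N \<and> c < N"
proof -
  have "finite ((\<lambda>(a, b, c). a + b + c) ` F)"
    using assms by simp
  then obtain N where N: "\<forall>s \<in> (\<lambda>(a, b, c). a + b + c) ` F. s < N"
    using finite_nat_set_iff_bounded by blast
  have "a < N \<and> b < N \<and> c < N" if "(a, b, c) \<in> F" for a b c
    using N that by fastforce
  then show thesis by (rule that)
qed

lemma strictly_increasing_lower_bound: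
  fixes g :: "nat \<Rightarrow> nat"
  assumes "\<And>n. N \<le> n \<Longrightarrow> g n < g (Suc n)" and "N \<le> n"
  shows "n \<le> g n + N"
  using assms(2)
proof (induction n rule: dec_induct)
  case base
  then show ?case by simp
next
  case (step n)
  then show ?case using assms(1)[of n] by linarith
qed

text \<open>
  The comparison of growth rates behind (i): the leading coefficient on the left exceeds the one
  on the right, so the inequality fails for large \<open>m\<close>.
\<close>

lemma quadratic_growth_contradiction:
  fixes p d e k :: nat
  assumes "\<And>m. Suc p * (m * m) \<le> d + p * ((m + k) * (m + k)) + e * (m + k)"
  shows False
proof -
  define c0 where "c0 = d + p * (k * k) + e * k"
  define c1 where "c1 = 2 * p * k + e"
  define m where "m = c0 + c1 + 1"
  have "m * m \<le> c0 + c1 * m"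
    using assms[of m] unfolding c0_def c1_def by (simp add: algebra_simps)
  moreover have "m * m = c0 * m + c1 * m + m"
    unfolding m_def by (simp add: algebra_simps)
  moreover have "c0 < c0 * m + m"
    unfolding m_def by (simp add: algebra_simps)
  ultimately show False by linarith
qed

section \<open>Axis-preserving monotone maps do not increase coordinates\<close>

text \<open>
  The situation of the theorem with the partial map split into its domain and a total function,
  and with the axes written out, so that it can be transported along a rotation of coordinates.
\<close>

locale axis_preserving_map =
  fixes D :: "triple set" and f :: "triple \<Rightarrow> triple"
  assumes dom_subset: "D \<subseteq> N3"
    and ran_subset: "f ` D \<subseteq> N3"
    and cofinite_dom: "finite (N3 - D)"
    and cofinite_ran: "finite (N3 - f ` D)"
    and inj: "inj_on f D"
    and mono: "\<And>x y. x \<in> D \<Longrightarrow> y \<in> D \<Longrightarrow> x \<le> y \<Longrightarrow> f x \<le> f y"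
    and axis1: "\<And>a. (a, 1, 1) \<in> D \<Longrightarrow> \<exists>a'. f (a, 1, 1) = (a', 1, 1)"
    and axis2: "\<And>b. (1, b, 1) \<in> D \<Longrightarrow> \<exists>b'. f (1, b, 1) = (1, b', 1)"
    and axis3: "\<And>c. (1, 1, c) \<in> D \<Longrightarrow> \<exists>c'. f (1, 1, c) = (1, 1, c')"
begin

lemma strict_mono: "x \<in> D \<Longrightarrow> y \<in> D \<Longrightarrow> x < y \<Longrightarrow> f x < f y"
  using mono[of x y] inj by (auto simp: less_le inj_on_def)

text \<open>
  Since \<open>f\<close> is strictly increasing along each axis, it moves the points of an axis towards the
  origin by at most a constant, once they lie beyond the finitely many gaps of the domain.
\<close>

lemma axis_images_lower_bound:
  obtains N
  where "\<And>n. N \<le> n \<Longrightarrow> (n, 1, 1) \<in> D \<and> (\<exists>a. f (n, 1, 1) = (a, 1, 1) \<and> n \<le> a + N)"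
    and "\<And>n. N \<le> n \<Longrightarrow> (1, n, 1) \<in> D \<and> (\<exists>b. f (1, n, 1) = (1, b, 1) \<and> n \<le> b + N)"
    and "\<And>n. N \<le> n \<Longrightarrow> (1, 1, n) \<in> D \<and> (\<exists>c. f (1, 1, n) = (1, 1, c) \<and> n \<le> c + N)"
proof -
  obtain N0 where N0: "\<And>a b c. (a, b, c) \<in> N3 - D \<Longrightarrow> a < N0 \<and> b < N0 \<and> c < N0"
    using finite_triples_bounded[OF cofinite_dom] by blast
  define N where "N = Suc N0"
  have D1: "(n, 1, 1) \<in> D" if "N \<le> n" for n
    using N0[of n 1 1] that by (cases "(n, 1, 1) \<in> D") (auto simp: N_def)
  have D2: "(1, n, 1) \<in> D" if "N \<le> n" for n
    using N0[of 1 n 1] that by (cases "(1, n, 1) \<in> D") (auto simp: N_def)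
  have D3: "(1, 1, n) \<in> D" if "N \<le> n" for n
    using N0[of 1 1 n] that by (cases "(1, 1, n) \<in> D") (auto simp: N_def)
  obtain g1 where g1: "\<And>n. N \<le> n \<Longrightarrow> f (n, 1, 1) = (g1 n, 1, 1)"
    using axis1[OF D1] by metis
  obtain g2 where g2: "\<And>n. N \<le> n \<Longrightarrow> f (1, n, 1) = (1, g2 n, 1)"
    using axis2[OF D2] by metis
  obtain g3 where g3: "\<And>n. N \<le> n \<Longrightarrow> f (1, 1, n) = (1, 1, g3 n)"
    using axis3[OF D3] by metis
  have "g1 n < g1 (Suc n)" if "N \<le> n" for n
    using strict_mono[OF D1[OF that] D1[of "Suc n"]] g1[of n] g1[of "Suc n"] that
    by (simp add: less_le_not_le)
  then have "n \<le> g1 n + N" if "N \<le> n" for n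
    using strictly_increasing_lower_bound that by blast
  moreover
  have "g2 n < g2 (Suc n)" if "N \<le> n" for n
    using strict_mono[OF D2[OF that] D2[of "Suc n"]] g2[of n] g2[of "Suc n"] that
    by (simp add: less_le_not_le)
  then have "n \<le> g2 n + N" if "N \<le> n" for n
    using strictly_increasing_lower_bound that by blast
  moreover
  have "g3 n < g3 (Suc n)" if "N \<le> n" for n
    using strict_mono[OF D3[OF that] D3[of "Suc n"]] g3[of n] g3[of "Suc n"] that
    by (simp add: less_le_not_le)
  then have "n \<le> g3 n + N" if "N \<le> n" for n
    using strictly_increasing_lower_bound that by blast
  ultimately show thesis
    using that[of N] D1 D2 D3 g1 g2 g3 by auto
qed

text \<open>
  Monotonicity read contrapositively: a value of \<open>f\<close> that is above none of the images
  of four points of the domain comes from a point that is above none of the four points. The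
  inequality counts both sides.
\<close>

lemma count_points_not_above:
  assumes x: "(x1, x2, x3) \<in> D" "f (x1, x2, x3) = (y1, y2, y3)"
    and A: "(A, 1, 1) \<in> D" "f (A, 1, 1) = (A', 1, 1)" "y1 \<le> A'"
    and B: "(1, n, 1) \<in> D" "f (1, n, 1) = (1, B, 1)"
    and C: "(1, 1, n) \<in> D" "f (1, 1, n) = (1, 1, C)"
  shows "(y1 - 1) * ((B - 1) * (C - 1))
          \<le> card (N3 - f ` D) + (x1 - 1) * (n * n) + A * (x2 + x3) * n"
proof -
  let ?T = "{1..<y1} \<times> {1..<B} \<times> {1..<C}"
  let ?S1 = "{1..<x1} \<times> {1..<n} \<times> {1..<n}"
  let ?S2 = "{1..<A} \<times> {1..<x2} \<times> {1..<n}"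
  let ?S3 = "{1..<A} \<times> {1..<n} \<times> {1..<x3}"
  let ?S = "?S1 \<union> (?S2 \<union> ?S3)"
  have "?T \<subseteq> (N3 - f ` D) \<union> f ` ?S"
  proof
    fix t assume t: "t \<in> ?T"
    then have tN: "t \<in> N3" by auto
    show "t \<in> (N3 - f ` D) \<union> f ` ?S"
    proof (cases "t \<in> f ` D")
      case False
      with tN show ?thesis by simp
    next
      case True
      then obtain z where z: "z \<in> D" "t = f z" by auto
      obtain z1 z2 z3 where zz: "z = (z1, z2, z3)" by (cases z)
      have pos: "1 \<le> z1" "1 \<le> z2" "1 \<le> z3"
        using z dom_subset zz by auto
      have "\<not> (x1, x2, x3) \<le> z"
        using mono[OF x(1) z(1)] t x(2) z(2) by (auto simp: zz less_eq_prod_def)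
      moreover have "\<not> (A, 1, 1) \<le> z"
        using mono[OF A(1) z(1)] t A(2,3) z(2) by (auto simp: zz less_eq_prod_def)
      moreover have "\<not> (1, n, 1) \<le> z"
        using mono[OF B(1) z(1)] t B(2) z(2) by (auto simp: zz less_eq_prod_def)
      moreover have "\<not> (1, 1, n) \<le> z"
        using mono[OF C(1) z(1)] t C(2) z(2) by (auto simp: zz less_eq_prod_def)
      ultimately have "z \<in> ?S"
        using pos by (auto simp: zz)
      with z(2) show ?thesis by blast
    qed
  qed
  then have "card ?T \<le> card ((N3 - f ` D) \<union> f ` ?S)"
    using cofinite_ran by (intro card_mono) auto
  also have "\<dots> \<le> card (N3 - f ` D) + card (f ` ?S)"
    by (rule card_Un_le)
  also have "card (f ` ?S) \<le> card ?S"
    by (intro card_image_le) auto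
  also have "card ?S \<le> card ?S1 + (card ?S2 + card ?S3)"
    by (meson card_Un_le add_left_mono le_trans)
  also have "card ?S1 \<le> (x1 - 1) * (n * n)"
    by (simp add: card_cartesian_product mult_le_mono)
  also have "card ?S2 \<le> A * (x2 * n)"
    unfolding card_cartesian_product by (intro mult_le_mono) auto
  also have "card ?S3 \<le> A * (n * x3)"
    unfolding card_cartesian_product by (intro mult_le_mono) auto
  finally show ?thesis
    by (simp add: card_cartesian_product algebra_simps)
qed

lemma fst_image_le:
  assumes x: "(x1, x2, x3) \<in> D" "f (x1, x2, x3) = (y1, y2, y3)"
  shows "y1 \<le> x1"
proof (rule ccontr)
  assume less: "\<not> y1 \<le> x1"
  have "1 \<le> x1" using x(1) dom_subset by auto
  obtain N
    where N1: "\<And>n. N \<le> n \<Longrightarrow> (n, 1, 1) \<in> D \<and> (\<exists>a. f (n, 1, 1) = (a, 1, 1) \<and> n \<le> a + N)"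
    and N2: "\<And>n. N \<le> n \<Longrightarrow> (1, n, 1) \<in> D \<and> (\<exists>b. f (1, n, 1) = (1, b, 1) \<and> n \<le> b + N)"
    and N3: "\<And>n. N \<le> n \<Longrightarrow> (1, 1, n) \<in> D \<and> (\<exists>c. f (1, 1, n) = (1, 1, c) \<and> n \<le> c + N)"
    using axis_images_lower_bound by blast
  \<comment> \<open>far enough out for the first coordinate of its image to reach \<open>y1\<close>\<close>
  define A where "A = N + y1"
  obtain A' where A: "(A, 1, 1) \<in> D" "f (A, 1, 1) = (A', 1, 1)" "y1 \<le> A'"
    using N1[of A] unfolding A_def by auto
  have "Suc (x1 - 1) * (m * m)
      \<le> card (N3 - f ` D) + (x1 - 1) * ((m + Suc N) * (m + Suc N)) + (A * (x2 + x3)) * (m + Suc N)"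
    for m
  proof -
    let ?n = "m + Suc N"
    obtain B where B: "(1, ?n, 1) \<in> D" "f (1, ?n, 1) = (1, B, 1)" "?n \<le> B + N"
      using N2[of ?n] by auto
    obtain C where C: "(1, 1, ?n) \<in> D" "f (1, 1, ?n) = (1, 1, C)" "?n \<le> C + N"
      using N3[of ?n] by auto
    have "Suc (x1 - 1) * (m * m) \<le> (y1 - 1) * ((B - 1) * (C - 1))"
      using less B(3) C(3) \<open>1 \<le> x1\<close> by (intro mult_le_mono) auto
    also have "\<dots> \<le> card (N3 - f ` D) + (x1 - 1) * (?n * ?n) + A * (x2 + x3) * ?n"
      by (rule count_points_not_above[OF x A B(1,2) C(1,2)])
    finally show ?thesis .
  qed
  then show False by (rule quadratic_growth_contradiction)
qed

end

fun rot :: "triple \<Rightarrow> triple" where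
  "rot (a, b, c) = (b, c, a)"

lemma rot_rot_rot [simp]: "rot (rot (rot x)) = x"
  by (cases x) simp

lemma rot_eq_iff [simp]: "rot x = rot y \<longleftrightarrow> x = y"
  by (metis rot_rot_rot)

lemma inj_rot: "inj_on rot S"
  by (simp add: inj_on_def)

lemma rot_le_iff [simp]: "rot x \<le> rot y \<longleftrightarrow> x \<le> y"
  by (cases x; cases y) auto

lemma rot_image_N3: "rot ` N3 = N3"
proof
  show "rot ` N3 \<subseteq> N3" by (auto simp: N3_def)
  show "N3 \<subseteq> rot ` N3"
  proof
    fix x assume "x \<in> N3"
    then have "rot (rot x) \<in> N3" by (cases x) simp
    then show "x \<in> rot ` N3" by (metis imageI rot_rot_rot)
  qed
qed

context axis_preserving_map
begin

text \<open>
  Conjugation by the rotation; \<open>rot \<circ> rot\<close> is the inverse of \<open>rot\<close>. Applying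
  \<open>fst_image_le\<close> to the conjugates of \<open>f\<close> bounds the remaining coordinates.
\<close>

lemma rotated: "axis_preserving_map (rot ` D) (\<lambda>x. rot (f (rot (rot x))))"
proof
  have image: "(\<lambda>x. rot (f (rot (rot x)))) ` (rot ` D) = rot ` (f ` D)"
    by (simp add: image_image)
  show "rot ` D \<subseteq> N3"
    using dom_subset rot_image_N3 by blast
  show "(\<lambda>x. rot (f (rot (rot x)))) ` (rot ` D) \<subseteq> N3"
    unfolding image using ran_subset rot_image_N3 by blast
  show "finite (N3 - rot ` D)"
    using finite_imageI[OF cofinite_dom, of rot]
    by (simp add: image_set_diff[OF inj_rot] rot_image_N3)
  show "finite (N3 - (\<lambda>x. rot (f (rot (rot x)))) ` (rot ` D))"
    unfolding image using finite_imageI[OF cofinite_ran, of rot]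
    by (simp add: image_set_diff[OF inj_rot] rot_image_N3)
  show "inj_on (\<lambda>x. rot (f (rot (rot x)))) (rot ` D)"
    using inj unfolding inj_on_def by simp
  show "rot (f (rot (rot x))) \<le> rot (f (rot (rot y)))"
    if "x \<in> rot ` D" "y \<in> rot ` D" "x \<le> y" for x y
    using that mono by auto
  have preimage: "rot (rot x) \<in> D" if "x \<in> rot ` D" for x
    using that by auto
  show "\<exists>a'. rot (f (rot (rot (a, 1, 1)))) = (a', 1, 1)" if "(a, 1, 1) \<in> rot ` D" for a
    using axis2[of a] preimage[OF that] by auto
  show "\<exists>b'. rot (f (rot (rot (1, b, 1)))) = (1, b', 1)" if "(1, b, 1) \<in> rot ` D" for b
    using axis3[of b] preimage[OF that] by auto
  show "\<exists>c'. rot (f (rot (rot (1, 1, c)))) = (1, 1, c')" if "(1, 1, c) \<in> rot ` D" for c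
    using axis1[of c] preimage[OF that] by auto
qed

lemma image_coords_le:
  assumes x: "(x1, x2, x3) \<in> D" "f (x1, x2, x3) = (y1, y2, y3)"
  shows "y1 \<le> x1 \<and> y2 \<le> x2 \<and> y3 \<le> x3"
proof -
  interpret r: axis_preserving_map "rot ` D" "\<lambda>x. rot (f (rot (rot x)))"
    by (rule rotated)
  interpret rr: axis_preserving_map "rot ` rot ` D"
    "\<lambda>x. rot (rot (f (rot (rot (rot (rot x))))))"
    by (rule r.rotated)
  have "(x2, x3, x1) \<in> rot ` D"
    using imageI[OF x(1), of rot] by simp
  moreover from this have "(x3, x1, x2) \<in> rot ` rot ` D"
    using imageI[of "(x2, x3, x1)" "rot ` D" rot] by simp
  ultimately show ?thesis
    using fst_image_le[OF x] r.fst_image_le[of x2 x3 x1 y2 y3 y1]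
      rr.fst_image_le[of x3 x1 x2 y3 y1 y2] x(2) by simp
qed

section \<open>Points far from the coordinate planes are fixed\<close>

text \<open>
  The points of the domain in the box below \<open>(a,b,c)\<close> are mapped injectively into the box below
  its image. If the image has a smaller coordinate, the latter box is contained in the former
  with a face removed, so at least that many points are missing from the domain.
\<close>

lemma face_le_missing:
  assumes x: "(a, b, c) \<in> D" and moved: "f (a, b, c) \<noteq> (a, b, c)"
  shows "b * c \<le> card (N3 - D) \<or> a * c \<le> card (N3 - D) \<or> a * b \<le> card (N3 - D)"
proof -
  obtain a' b' c' where x': "f (a, b, c) = (a', b', c')"
    by (cases "f (a, b, c)")
  have le: "a' \<le> a" "b' \<le> b" "c' \<le> c"
    using image_coords_le[OF x x'] by auto
  have pos: "1 \<le> a" "1 \<le> b" "1 \<le> c"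
    using x dom_subset by auto
  let ?box = "\<lambda>p q r. {1..p} \<times> {1..q} \<times> {1..r} :: triple set"
  have "f ` (?box a b c \<inter> D) \<subseteq> ?box a' b' c'"
  proof
    fix t assume "t \<in> f ` (?box a b c \<inter> D)"
    then obtain z where z: "z \<in> ?box a b c" "z \<in> D" "t = f z" by auto
    have "f z \<le> (a', b', c')"
      using mono[OF z(2) x] z(1) x' by auto
    moreover have "f z \<in> N3" using z(2) ran_subset by auto
    ultimately show "t \<in> ?box a' b' c'"
      using z(3) by (cases "f z") auto
  qed
  then have "card (f ` (?box a b c \<inter> D)) \<le> card (?box a' b' c')"
    by (intro card_mono) auto
  then have "card (?box a b c \<inter> D) \<le> card (?box a' b' c')"
    using inj by (simp add: card_image inj_on_subset)
  moreover have "card (?box a b c) \<le> card ((?box a b c \<inter> D) \<union> (N3 - D))"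
    using cofinite_dom by (intro card_mono) auto
  ultimately have "card (?box a b c) \<le> card (?box a' b' c') + card (N3 - D)"
    using card_Un_le[of "?box a b c \<inter> D" "N3 - D"] by linarith
  then have count: "a * (b * c) \<le> a' * (b' * c') + card (N3 - D)"
    by (simp add: card_cartesian_product)
  from moved x' le consider "a' \<le> a - 1" | "b' \<le> b - 1" | "c' \<le> c - 1"
    by fastforce
  then show ?thesis
  proof cases
    case 1
    have "a' * (b' * c') \<le> (a - 1) * (b * c)"
      using 1 le by (intro mult_le_mono)
    moreover have "a * (b * c) = (a - 1) * (b * c) + b * c"
      using pos by (cases a) simp_all
    ultimately show ?thesis using count by linarith
  next
    case 2
    have "a' * (b' * c') \<le> a * ((b - 1) * c)"
      using 2 le by (intro mult_le_mono)
    moreover have "a * (b * c) = a * ((b - 1) * c) + a * c"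
      using pos by (cases b) (simp_all add: algebra_simps)
    ultimately show ?thesis using count by linarith
  next
    case 3
    have "a' * (b' * c') \<le> a * (b * (c - 1))"
      using 3 le by (intro mult_le_mono)
    moreover have "a * (b * c) = a * (b * (c - 1)) + a * b"
      using pos by (cases c) (simp_all add: algebra_simps)
    ultimately show ?thesis using count by linarith
  qed
qed

lemma fixes_far_points:
  assumes "x \<in> D" and "x \<in> up (n, n, n)" and n: "card (N3 - D) < n"
  shows "f x = x"
proof (rule ccontr)
  assume "f x \<noteq> x"
  obtain a b c where x: "x = (a, b, c)" by (cases x)
  have ge: "n \<le> a" "n \<le> b" "n \<le> c"
    using assms(2) by (auto simp: x up_def)
  have face: "n \<le> p * q" if "n \<le> p" "n \<le> q" for p q
    using mult_le_mono[of n p 1 q] that n by simp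
  show False
    using face_le_missing[of a b c] assms(1) \<open>f x \<noteq> x\<close> n
      face[OF ge(2,3)] face[OF ge(1,3)] face[OF ge(1,2)] by (auto simp: x)
qed

end

lemma K_simps:
  "(a, b, c) \<in> K 1 \<longleftrightarrow> 1 \<le> a \<and> b = 1 \<and> c = 1"
  "(a, b, c) \<in> K 2 \<longleftrightarrow> 1 \<le> b \<and> a = 1 \<and> c = 1"
  "(a, b, c) \<in> K 3 \<longleftrightarrow> 1 \<le> c \<and> a = 1 \<and> b = 1"
  by (auto simp: K_def)

lemma axis_preserving_map_of_PO_inf:
  assumes \<alpha>: "\<alpha> \<in> PO_inf"
    and axes: "\<forall>i\<in>{1, 2, 3}. (the \<circ> \<alpha>) ` (K i \<inter> dom \<alpha>) \<subseteq> K i"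
  shows "axis_preserving_map (dom \<alpha>) (the \<circ> \<alpha>)"
proof
  have ran: "(the \<circ> \<alpha>) ` dom \<alpha> = ran \<alpha>"
    by (force simp: ran_def dom_def image_iff)
  show "dom \<alpha> \<subseteq> N3" "(the \<circ> \<alpha>) ` dom \<alpha> \<subseteq> N3" "finite (N3 - dom \<alpha>)"
    "finite (N3 - (the \<circ> \<alpha>) ` dom \<alpha>)" "inj_on (the \<circ> \<alpha>) (dom \<alpha>)"
    using \<alpha> unfolding ran PO_inf_def by auto
  show "(the \<circ> \<alpha>) x \<le> (the \<circ> \<alpha>) y" if "x \<in> dom \<alpha>" "y \<in> dom \<alpha>" "x \<le> y" for x y
    using \<alpha> that unfolding PO_inf_def monotone_on_def by blast
  have pos: "1 \<le> a \<and> 1 \<le> b \<and> 1 \<le> c" if "(a, b, c) \<in> dom \<alpha>" for a b c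
    using \<alpha> that unfolding PO_inf_def by auto
  have K: "(the \<circ> \<alpha>) x \<in> K i" if "i \<in> {1, 2, 3}" "x \<in> K i" "x \<in> dom \<alpha>" for i x
    using axes that by blast
  show "\<exists>a'. (the \<circ> \<alpha>) (a, 1, 1) = (a', 1, 1)" if "(a, 1, 1) \<in> dom \<alpha>" for a
    using K[of 1 "(a, 1, 1)"] pos[OF that] that
    by (cases "(the \<circ> \<alpha>) (a, 1, 1)") (auto simp only: K_simps insert_iff)
  show "\<exists>b'. (the \<circ> \<alpha>) (1, b, 1) = (1, b', 1)" if "(1, b, 1) \<in> dom \<alpha>" for b
    using K[of 2 "(1, b, 1)"] pos[OF that] that
    by (cases "(the \<circ> \<alpha>) (1, b, 1)") (auto simp only: K_simps insert_iff)
  show "\<exists>c'. (the \<circ> \<alpha>) (1, 1, c) = (1, 1, c')" if "(1, 1, c) \<in> dom \<alpha>" for c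
    using K[of 3 "(1, 1, c)"] pos[OF that] that
    by (cases "(the \<circ> \<alpha>) (1, 1, c)") (auto simp only: K_simps insert_iff)
qed

theorem theorem2p10:
  fixes \<alpha> :: "triple \<rightharpoonup> triple"
  assumes "\<alpha> \<in> PO_inf"
    and "\<forall>i\<in>{1, 2, 3}. (the \<circ> \<alpha>) ` (K i \<inter> dom \<alpha>) \<subseteq> K i"
  shows "((\<forall>x1 x2 x3 y1 y2 y3. \<alpha> (x1, x2, x3) = Some (y1, y2, y3) \<longrightarrow>
             y1 \<le> x1 \<and> y2 \<le> x2 \<and> y3 \<le> x3) \<and>
          (\<forall>x\<in>dom \<alpha>. the (\<alpha> x) \<le> x)) \<and>
         (\<exists>n::nat. n \<ge> 1 \<and> (\<forall>x\<in>dom \<alpha> \<inter> up (n, n, n). \<alpha> x = Some x) \<and>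
            (\<forall>m::nat. m \<ge> 1 \<and> (\<forall>x\<in>dom \<alpha> \<inter> up (m, m, m). \<alpha> x = Some x) \<longrightarrow> n \<le> m))"
proof -
  interpret axis_preserving_map "dom \<alpha>" "the \<circ> \<alpha>"
    using assms by (rule axis_preserving_map_of_PO_inf)
  have coords: "y1 \<le> x1 \<and> y2 \<le> x2 \<and> y3 \<le> x3"
    if "\<alpha> (x1, x2, x3) = Some (y1, y2, y3)" for x1 x2 x3 y1 y2 y3
    using image_coords_le[of x1 x2 x3 y1 y2 y3] that by auto
  have le: "the (\<alpha> x) \<le> x" if "x \<in> dom \<alpha>" for x
  proof -
    obtain x1 x2 x3 y1 y2 y3 where "x = (x1, x2, x3)" "\<alpha> x = Some (y1, y2, y3)"
      using \<open>x \<in> dom \<alpha>\<close> by (metis domD prod_cases3)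
    then show ?thesis using coords by auto
  qed
  define P where "P n \<longleftrightarrow> n \<ge> 1 \<and> (\<forall>x\<in>dom \<alpha> \<inter> up (n, n, n). \<alpha> x = Some x)" for n
  have "P (Suc (card (N3 - dom \<alpha>)))"
    unfolding P_def using fixes_far_points by fastforce
  then have "P (LEAST n. P n)" by (rule LeastI)
  moreover have "(LEAST n. P n) \<le> m" if "P m" for m
    using that by (rule Least_le)
  ultimately have "\<exists>n. P n \<and> (\<forall>m. P m \<longrightarrow> n \<le> m)" by blast
  then show ?thesis
    unfolding P_def using coords le by auto
qed

end
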